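(* Let $k>1$ be an integer and $\sigma$ a permutation of $\{0,1,\ldots,n\}$. Every perfect $(\sigma,k)$-permutiple $[a_0;a_1,\ldots,a_n]$ is a Landess permutiple.
   Context: For positive integers $a_0,\ldots,a_n$, $[a_0;a_1,\ldots,a_n]$ denotes the finite simple continued fraction $a_0+1/(a_1+1/(\cdots+1/a_n))$; all finite continued fractions are assumed in canonical form (last digit at least $2$ when there are at least two digits). For an integer $k>1$ and a permutation $\sigma$ of $\{0,\ldots,n\}$, $r=[a_0;\ldots,a_n]$ is a $(\sigma,k)$-permutiple if $r=k\,[a_{\sigma(0)};a_{\sigma(1)},\ldots,a_{\sigma(n)}]$. It is perfect if $a_j=k\,a_{\sigma(j)}$ for every even $j$ and $a_{\sigma(j)}=k\,a_j$ for every odd $j$ ($0\le j\le n$). Continuants: $K_0()=1$, $K_1(x_0)=x_0$, $K_m(x_0,\ldots,x_{m-1})=x_{m-1}K_{m-1}(x_0,\ldots,x_{m-2})+K_{m-2}(x_0,\ldots,x_{m-3})$. Let $p_j=K_{j+1}(a_0,\ldots,a_j)$, $q_j=K_j(a_1,\ldots,a_j)$, $p'_j=K_{j+1}(a_{\sigma(0)},\ldots,a_{\sigma(j)})$, $q'_j=K_j(a_{\sigma(1)},\ldots,a_{\sigma(j)})$. The permutiple is continuant-preserving if $p_n=p'_n$, and it is a Landess permutiple if it is continuant-preserving and $q_{n-1}=q'_{n-1}$ and $p_{n-1}=k\,p'_{n-1}$. *)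

theory Defs
  imports Complex_Main "HOL-Combinatorics.Permutations"
begin

text \<open>
  A digit string is a function \<open>a :: nat \<Rightarrow> nat\<close> together with its last index \<open>n\<close>;
  values of \<open>a\<close> beyond \<open>n\<close> are irrelevant. The permuted digits
  \<open>a\<^bsub>\<sigma>(0)\<^esub>, \<dots>, a\<^bsub>\<sigma>(n)\<^esub>\<close> are \<open>a \<circ> \<sigma>\<close>.
\<close>

fun cfrac_val :: "(nat \<Rightarrow> nat) \<Rightarrow> nat \<Rightarrow> rat" where
  "cfrac_val a 0 = of_nat (a 0)"
| "cfrac_val a (Suc n) = of_nat (a 0) + 1 / cfrac_val (\<lambda>i. a (Suc i)) n"

definition canonical_digits :: "(nat \<Rightarrow> nat) \<Rightarrow> nat \<Rightarrow> bool" where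
  "canonical_digits a n \<longleftrightarrow> (\<forall>j\<le>n. 0 < a j) \<and> (0 < n \<longrightarrow> 2 \<le> a n)"

definition permutiple :: "(nat \<Rightarrow> nat) \<Rightarrow> nat \<Rightarrow> nat \<Rightarrow> (nat \<Rightarrow> nat) \<Rightarrow> bool" where
  "permutiple \<sigma> k n a \<longleftrightarrow>
     1 < k \<and> \<sigma> permutes {0..n} \<and>
     canonical_digits a n \<and> canonical_digits (a \<circ> \<sigma>) n \<and>
     cfrac_val a n = of_nat k * cfrac_val (a \<circ> \<sigma>) n"

definition perfect_permutiple :: "(nat \<Rightarrow> nat) \<Rightarrow> nat \<Rightarrow> nat \<Rightarrow> (nat \<Rightarrow> nat) \<Rightarrow> bool" where
  "perfect_permutiple \<sigma> k n a \<longleftrightarrow>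
     permutiple \<sigma> k n a \<and>
     (\<forall>j\<le>n. (even j \<longrightarrow> a j = k * a (\<sigma> j)) \<and> (odd j \<longrightarrow> a (\<sigma> j) = k * a j))"

text \<open>\<open>continuant m x\<close> is \<open>K\<^sub>m(x\<^sub>0, \<dots>, x\<^bsub>m-1\<^esub>)\<close>.\<close>

fun continuant :: "nat \<Rightarrow> (nat \<Rightarrow> nat) \<Rightarrow> nat" where
  "continuant 0 x = 1"
| "continuant (Suc 0) x = x 0"
| "continuant (Suc (Suc m)) x = x (Suc m) * continuant (Suc m) x + continuant m x"

definition conv_num :: "(nat \<Rightarrow> nat) \<Rightarrow> nat \<Rightarrow> nat" where
  "conv_num a j = continuant (Suc j) a"

definition conv_denom :: "(nat \<Rightarrow> nat) \<Rightarrow> nat \<Rightarrow> nat" where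
  "conv_denom a j = continuant j (\<lambda>i. a (Suc i))"

definition continuant_preserving ::
    "(nat \<Rightarrow> nat) \<Rightarrow> nat \<Rightarrow> nat \<Rightarrow> (nat \<Rightarrow> nat) \<Rightarrow> bool" where
  "continuant_preserving \<sigma> k n a \<longleftrightarrow>
     permutiple \<sigma> k n a \<and> conv_num a n = conv_num (a \<circ> \<sigma>) n"

text \<open>
  The Landess conditions involve the index \<open>n - 1\<close>. For \<open>n = 0\<close> the usual convention
  \<open>p\<^bsub>-1\<^esub> = p'\<^bsub>-1\<^esub> = 1\<close> makes \<open>p\<^bsub>-1\<^esub> = k p'\<^bsub>-1\<^esub>\<close>
  false for \<open>k > 1\<close>; the conjunct \<open>0 < n\<close> gives the same result and keeps the
  natural-number subtraction from truncating.
\<close>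

definition landess_permutiple :: "(nat \<Rightarrow> nat) \<Rightarrow> nat \<Rightarrow> nat \<Rightarrow> (nat \<Rightarrow> nat) \<Rightarrow> bool" where
  "landess_permutiple \<sigma> k n a \<longleftrightarrow>
     continuant_preserving \<sigma> k n a \<and> 0 < n \<and>
     conv_denom a (n - 1) = conv_denom (a \<circ> \<sigma>) (n - 1) \<and>
     conv_num a (n - 1) = k * conv_num (a \<circ> \<sigma>) (n - 1)"

end

theory Submission
  imports Defs
begin

text \<open>
  Write \<open>b = a \<circ> \<sigma>\<close>. Perfectness says that \<open>a\<close> arises from \<open>b\<close> by multiplying the digits alternately
  by \<open>k\<close> and \<open>1/k\<close>, which multiplies a continuant of length \<open>m\<close> by \<open>k\<close> if \<open>m\<close> is odd and leaves it
  unchanged if \<open>m\<close> is even; the product of the first \<open>m\<close> digits behaves in the same way. Since a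
  permutation preserves the product of all \<open>n + 1\<close> digits, which is positive, \<open>n\<close> is odd. The three
  Landess conditions are then the scaling rule at the lengths \<open>n + 1\<close>, \<open>n - 1\<close> and \<open>n\<close>.
\<close>

text \<open>Both summands of the recurrence scale alike: the factor \<open>k\<close> or
  \<open>1/k\<close> of the new digit times the factor at length \<open>m + 1\<close> is the factor
  at length \<open>m\<close>.\<close>

lemma continuant_alternating_scaling:
  assumes "\<And>j. j < m \<Longrightarrow> even j \<Longrightarrow> a j = k * b j"
    and "\<And>j. j < m \<Longrightarrow> odd j \<Longrightarrow> b j = k * a j"
  shows "continuant m a = (if even m then 1 else k) * continuant m b"
  using assms
proof (induction m rule: induct_nat_012)
  case (ge2 m)
  have IH: "continuant m a = (if even m then 1 else k) * continuant m b"
    "continuant (Suc m) a = (if even (Suc m) then 1 else k) * continuant (Suc m) b"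
    using ge2 by simp_all
  show ?case
  proof (cases "even m")
    case True
    then have "b (Suc m) = k * a (Suc m)"
      using ge2.prems by simp
    with True IH show ?thesis
      by simp
  next
    case False
    then have "a (Suc m) = k * b (Suc m)"
      using ge2.prems by simp
    with False IH show ?thesis
      by (simp add: algebra_simps)
  qed
qed simp_all

lemma prod_alternating_scaling:
  fixes a b :: "nat \<Rightarrow> nat"
  assumes "\<And>j. j < m \<Longrightarrow> even j \<Longrightarrow> a j = k * b j"
    and "\<And>j. j < m \<Longrightarrow> odd j \<Longrightarrow> b j = k * a j"
  shows "prod a {..<m} = (if even m then 1 else k) * prod b {..<m}"
  using assms
proof (induction m)
  case (Suc m)
  have IH: "prod a {..<m} = (if even m then 1 else k) * prod b {..<m}"
    using Suc by simp
  show ?case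
  proof (cases "even m")
    case True
    then have "a m = k * b m"
      using Suc.prems by simp
    with True IH show ?thesis
      by simp
  next
    case False
    then have "b m = k * a m"
      using Suc.prems by simp
    with False IH show ?thesis
      by simp
  qed
qed simp

lemma perfect_permutiple_odd:
  assumes "perfect_permutiple \<sigma> k n a"
  shows "odd n"
proof
  assume "even n"
  have k: "1 < k" and perm: "\<sigma> permutes {..<Suc n}" and pos: "\<And>j. j \<le> n \<Longrightarrow> 0 < a j"
    using assms
    by (auto simp: perfect_permutiple_def permutiple_def canonical_digits_def
        lessThan_Suc_atMost atLeast0AtMost)
  \<comment> \<open>The length \<open>n + 1\<close> is odd here, so the factor is
    \<open>k\<close>.\<close>
  have "prod a {..<Suc n} = k * prod (a \<circ> \<sigma>) {..<Suc n}"
    using prod_alternating_scaling[of "Suc n" a k "a \<circ> \<sigma>"] assms \<open>even n\<close>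
    by (simp add: perfect_permutiple_def del: prod.lessThan_Suc)
  also have "prod (a \<circ> \<sigma>) {..<Suc n} = prod a {..<Suc n}"
    using prod.permute[OF perm, of a] by simp
  finally have "prod a {..<Suc n} = k * prod a {..<Suc n}" .
  moreover have "0 < prod a {..<Suc n}"
    using pos by (intro prod_pos) simp
  ultimately show False
    using k by (metis mult_cancel2 mult_1 less_irrefl)
qed

theorem theorem26:
  fixes \<sigma> :: "nat \<Rightarrow> nat" and k n :: nat and a :: "nat \<Rightarrow> nat"
  assumes "1 < k"
    and "\<sigma> permutes {0..n}"
    and "perfect_permutiple \<sigma> k n a"
  shows "landess_permutiple \<sigma> k n a"
proof -
  have "odd n"
    using assms(3) by (rule perfect_permutiple_odd)
  then have "0 < n"
    by (rule odd_pos)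
  have perm: "permutiple \<sigma> k n a"
    and ev: "\<And>j. j \<le> n \<Longrightarrow> even j \<Longrightarrow> a j = k * (a \<circ> \<sigma>) j"
    and od: "\<And>j. j \<le> n \<Longrightarrow> odd j \<Longrightarrow> (a \<circ> \<sigma>) j = k * a j"
    using assms(3) by (auto simp: perfect_permutiple_def)
  have "continuant (Suc n) a = continuant (Suc n) (a \<circ> \<sigma>)"
    using continuant_alternating_scaling[of "Suc n" a k "a \<circ> \<sigma>"] ev od \<open>odd n\<close> by simp
  moreover have "continuant n a = k * continuant n (a \<circ> \<sigma>)"
    using continuant_alternating_scaling[of n a k "a \<circ> \<sigma>"] ev od \<open>odd n\<close> by simp
  \<comment> \<open>Dropping the first digit exchanges the roles of \<open>a\<close> and \<open>a \<circ> \<sigma>\<close> in the scaling rule.\<close>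
  moreover have "continuant (n - 1) (\<lambda>i. (a \<circ> \<sigma>) (Suc i)) = continuant (n - 1) (\<lambda>i. a (Suc i))"
    using continuant_alternating_scaling[of "n - 1" "\<lambda>i. (a \<circ> \<sigma>) (Suc i)" k "\<lambda>i. a (Suc i)"]
      ev od \<open>odd n\<close> by simp
  ultimately show ?thesis
    \<comment> \<open>\<open>0 < n\<close> gives \<open>Suc (n - 1) = n\<close>, so the equation at
      length \<open>n\<close> is the one for \<open>conv_num\<close> at
      \<open>n - 1\<close>.\<close>
    using perm \<open>0 < n\<close>
    by (simp add: landess_permutiple_def continuant_preserving_def conv_num_def conv_denom_def)
qed

end
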